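(* Let $m\in\mathbb{R}$, let $\psi$ be analytic, and consider $$X:\qquad \dot x=\Phi(x,y):=\tfrac{1-m}{2}x^2+\psi(y),\qquad \dot y=-xy .$$ Then $V(x,y)=y^m$ is an inverse integrating factor for $X$, i.e. $\operatorname{div}(V^{-1}X)=0$, and $$I(x,y)=\tfrac12x^2y^{1-m}+\int^{y}\psi(s)\,s^{-m}\,ds$$ is a first integral of $X$ on $\{y\neq0\}$. Equivalently, $X=V\,X_I$ with $X_I=(\partial_yI,-\partial_xI)$. Conversely, within the class of planar vector fields $\dot x=\Phi(x,y)$ with $\dot y=-xy$, a monomial inverse integrating factor $y^m$ exists if and only if $\partial_x\Phi=(1-m)x$, i.e. if and only if $\Phi$ has the form $\Phi(x,y)=\tfrac{1-m}{2}x^2+\psi(y)$.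
   Context: An inverse integrating factor of a planar vector field $X$ is a function $V$ with $\operatorname{div}(V^{-1}X)=0$, equivalently $X\cdot\nabla V=V\operatorname{div}X$. A first integral of $X$ is a function $I$ constant along the orbits of $X$, i.e. $X\cdot\nabla I=0$. The symbol $\int^y$ denotes an antiderivative. *)

theory Defs
  imports "HOL-Analysis.Analysis"
begin

subsection \<open>Planar vector fields\<close>

definition partial_x :: "(real \<times> real \<Rightarrow> real) \<Rightarrow> real \<times> real \<Rightarrow> real" where
  "partial_x f p = deriv (\<lambda>x. f (x, snd p)) (fst p)"

definition partial_y :: "(real \<times> real \<Rightarrow> real) \<Rightarrow> real \<times> real \<Rightarrow> real" where
  "partial_y f p = deriv (\<lambda>y. f (fst p, y)) (snd p)"

definition divergence :: "(real \<times> real \<Rightarrow> real \<times> real) \<Rightarrow> real \<times> real \<Rightarrow> real" where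
  "divergence X p = partial_x (\<lambda>q. fst (X q)) p + partial_y (\<lambda>q. snd (X q)) p"

definition directional :: "(real \<times> real \<Rightarrow> real \<times> real) \<Rightarrow> (real \<times> real \<Rightarrow> real) \<Rightarrow> real \<times> real \<Rightarrow> real" where
  "directional X f p = fst (X p) * partial_x f p + snd (X p) * partial_y f p"

definition hamiltonian_field :: "(real \<times> real \<Rightarrow> real) \<Rightarrow> real \<times> real \<Rightarrow> real \<times> real" where
  "hamiltonian_field f p = (partial_y f p, - partial_x f p)"

text \<open>Differentiability is required explicitly because \<^const>\<open>deriv\<close> is unspecified
  where the derivative does not exist.\<close>

definition inverse_integrating_factor ::
    "(real \<times> real) set \<Rightarrow> (real \<times> real \<Rightarrow> real \<times> real) \<Rightarrow> (real \<times> real \<Rightarrow> real) \<Rightarrow> bool" where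
  "inverse_integrating_factor D X V \<longleftrightarrow>
     (\<forall>p\<in>D. X differentiable (at p) \<and> V differentiable (at p) \<and> V p \<noteq> 0 \<and>
            divergence (\<lambda>q. inverse (V q) *\<^sub>R X q) p = 0)"

definition first_integral ::
    "(real \<times> real) set \<Rightarrow> (real \<times> real \<Rightarrow> real \<times> real) \<Rightarrow> (real \<times> real \<Rightarrow> real) \<Rightarrow> bool" where
  "first_integral D X I \<longleftrightarrow> (\<forall>p\<in>D. I differentiable (at p) \<and> directional X I p = 0)"

lemma partials_of_differentiable:
  fixes f :: "real \<times> real \<Rightarrow> real"
  assumes "(f has_derivative f') (at p)"
  shows "((\<lambda>x. f (x, snd p)) has_real_derivative f' (1, 0)) (at (fst p))"
    and "((\<lambda>y. f (fst p, y)) has_real_derivative f' (0, 1)) (at (snd p))"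
proof -
  interpret bounded_linear f' using assms by (rule has_derivative_bounded_linear)
  have p: "(f has_derivative f') (at (fst p, snd p))" using assms by simp
  have "((\<lambda>x. (x, snd p)) has_derivative (\<lambda>h. (h, 0))) (at (fst p))"
    by (intro has_derivative_Pair has_derivative_ident has_derivative_const)
  from has_derivative_compose[OF this p]
  have "((\<lambda>x. f (x, snd p)) has_derivative (\<lambda>h. f' (h, 0))) (at (fst p))" .
  moreover have "(\<lambda>h. f' (h, 0)) = (*) (f' (1, 0))"
  proof
    show "f' (h, 0) = f' (1, 0) * h" for h
      using scaleR[of h "(1, 0)"] by (simp add: mult.commute)
  qed
  ultimately show "((\<lambda>x. f (x, snd p)) has_real_derivative f' (1, 0)) (at (fst p))"
    by (simp only: has_field_derivative_def)
  have "((\<lambda>y. (fst p, y)) has_derivative (\<lambda>h. (0, h))) (at (snd p))"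
    by (intro has_derivative_Pair has_derivative_ident has_derivative_const)
  from has_derivative_compose[OF this p]
  have "((\<lambda>y. f (fst p, y)) has_derivative (\<lambda>h. f' (0, h))) (at (snd p))" .
  moreover have "(\<lambda>h. f' (0, h)) = (*) (f' (0, 1))"
  proof
    show "f' (0, h) = f' (0, 1) * h" for h
      using scaleR[of h "(0, 1)"] by (simp add: mult.commute)
  qed
  ultimately show "((\<lambda>y. f (fst p, y)) has_real_derivative f' (0, 1)) (at (snd p))"
    by (simp only: has_field_derivative_def)
qed

lemma first_integral_constant_on_orbits:
  assumes "first_integral D X I"
    and "\<And>t. t \<in> {a<..<b} \<Longrightarrow> \<gamma> t \<in> D \<and> (\<gamma> has_vector_derivative X (\<gamma> t)) (at t)"
  shows "\<exists>c. \<forall>t\<in>{a<..<b}. I (\<gamma> t) = c"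
proof -
  have "((\<lambda>t. I (\<gamma> t)) has_derivative (\<lambda>h. 0)) (at t within {a<..<b})" if t: "t \<in> {a<..<b}" for t
  proof -
    from assms t obtain I' where I': "(I has_derivative I') (at (\<gamma> t))"
      and 0: "directional X I (\<gamma> t) = 0"
      by (auto simp: first_integral_def differentiable_def)
    interpret bounded_linear I' using I' by (rule has_derivative_bounded_linear)
    have "I' (X (\<gamma> t)) = I' (fst (X (\<gamma> t)) *\<^sub>R (1, 0) + snd (X (\<gamma> t)) *\<^sub>R (0, 1))"
      by simp
    also have "\<dots> = fst (X (\<gamma> t)) * I' (1, 0) + snd (X (\<gamma> t)) * I' (0, 1)"
      by (simp only: add scaleR real_scaleR_def)
    also have "\<dots> = 0"
      using 0 partials_of_differentiable[OF I', THEN DERIV_imp_deriv]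
      by (simp add: directional_def partial_x_def partial_y_def)
    finally have z: "I' (X (\<gamma> t)) = 0" .
    have "(\<gamma> has_derivative (\<lambda>h. h *\<^sub>R X (\<gamma> t))) (at t)"
      using assms(2)[OF t] by (simp add: has_vector_derivative_def)
    from has_derivative_compose[OF this I']
    have "((\<lambda>t. I (\<gamma> t)) has_derivative (\<lambda>h. 0)) (at t)"
      by (simp add: scaleR z)
    thus ?thesis by (rule has_derivative_at_withinI)
  qed
  thus ?thesis
    by (intro has_derivative_zero_constant) auto
qed

lemma inverse_integrating_factor_alt:
  "inverse_integrating_factor D X V \<longleftrightarrow>
     (\<forall>p\<in>D. X differentiable (at p) \<and> V differentiable (at p) \<and> V p \<noteq> 0 \<and>
            directional X V p = V p * divergence X p)"
proof -
  have "divergence (\<lambda>q. inverse (V q) *\<^sub>R X q) p =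
          (V p * divergence X p - directional X V p) / (V p)\<^sup>2"
    if X: "X differentiable (at p)" and V: "V differentiable (at p)" and nz: "V p \<noteq> 0" for p
  proof -
    from X obtain X' where X': "(X has_derivative X') (at p)" by (auto simp: differentiable_def)
    from V obtain V' where V': "(V has_derivative V') (at p)" by (auto simp: differentiable_def)
    note dx = partials_of_differentiable(1)[OF has_derivative_fst[OF X']]
    note dy = partials_of_differentiable(2)[OF has_derivative_snd[OF X']]
    note dv = partials_of_differentiable[OF V']
    have "((\<lambda>x. inverse (V (x, snd p)) * fst (X (x, snd p))) has_real_derivative
            (V p * fst (X' (1, 0)) - fst (X p) * V' (1, 0)) / (V p)\<^sup>2) (at (fst p))"
      using DERIV_mult[OF DERIV_inverse'[OF dv(1)] dx] nz
      by (simp add: field_simps power2_eq_square)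
    moreover have "((\<lambda>y. inverse (V (fst p, y)) * snd (X (fst p, y))) has_real_derivative
            (V p * snd (X' (0, 1)) - snd (X p) * V' (0, 1)) / (V p)\<^sup>2) (at (snd p))"
      using DERIV_mult[OF DERIV_inverse'[OF dv(2)] dy] nz
      by (simp add: field_simps power2_eq_square)
    ultimately have "divergence (\<lambda>q. inverse (V q) *\<^sub>R X q) p =
        (V p * fst (X' (1, 0)) - fst (X p) * V' (1, 0)) / (V p)\<^sup>2 +
        (V p * snd (X' (0, 1)) - snd (X p) * V' (0, 1)) / (V p)\<^sup>2"
      by (simp add: divergence_def partial_x_def partial_y_def DERIV_imp_deriv)
    moreover have "divergence X p = fst (X' (1, 0)) + snd (X' (0, 1))"
      using dx dy by (simp add: divergence_def partial_x_def partial_y_def DERIV_imp_deriv)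
    moreover have "directional X V p = fst (X p) * V' (1, 0) + snd (X p) * V' (0, 1)"
      using dv by (simp add: directional_def partial_x_def partial_y_def DERIV_imp_deriv)
    ultimately show ?thesis
      by (simp add: add_divide_distrib diff_divide_distrib distrib_left)
  qed
  thus ?thesis
    by (auto simp: inverse_integrating_factor_def)
qed

subsection \<open>Real-analytic functions\<close>

definition real_analytic :: "(real \<Rightarrow> real) \<Rightarrow> bool" where
  "real_analytic f \<longleftrightarrow> (\<forall>a. \<exists>F. (\<lambda>h. f (a + h)) has_fps_expansion F)"

definition real_analytic2 :: "(real \<times> real \<Rightarrow> real) \<Rightarrow> bool" where
  "real_analytic2 f \<longleftrightarrow>
     (\<forall>a b. \<exists>c :: nat \<Rightarrow> nat \<Rightarrow> real. \<exists>r>0. \<forall>h k. \<bar>h\<bar> < r \<longrightarrow> \<bar>k\<bar> < r \<longrightarrow>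
        ((\<lambda>(i, j). c i j * h ^ i * k ^ j) has_sum f (a + h, b + k)) UNIV)"

subsection \<open>The vector field, the monomial factor and the first integral\<close>

definition off_axis :: "(real \<times> real) set" where
  "off_axis = {p. snd p \<noteq> 0}"

definition planar_field :: "(real \<times> real \<Rightarrow> real) \<Rightarrow> real \<times> real \<Rightarrow> real \<times> real" where
  "planar_field \<Phi> = (\<lambda>(x, y). (\<Phi> (x, y), - x * y))"

definition quadratic_Phi :: "real \<Rightarrow> (real \<Rightarrow> real) \<Rightarrow> real \<times> real \<Rightarrow> real" where
  "quadratic_Phi m \<psi> = (\<lambda>(x, y). (1 - m) / 2 * x\<^sup>2 + \<psi> y)"

text \<open>The power \<open>y\<^sup>a\<close> for real \<open>a\<close> and \<open>y \<noteq> 0\<close>. It is the usual real number when \<open>y > 0\<close> or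
  \<open>a\<close> is an integer. For \<open>y < 0\<close> and non-integer \<open>a\<close> no real value of \<open>y\<^sup>a\<close> is available in
  general; dropping the constant phase of the complex value leaves \<open>\<bar>y\<bar>\<^sup>a\<close>.\<close>

definition rpow :: "real \<Rightarrow> real \<Rightarrow> real" where
  "rpow y a = (if a \<in> \<int> then y powi \<lfloor>a\<rfloor> else \<bar>y\<bar> powr a)"

lemma rpow_pos: "y > 0 \<Longrightarrow> rpow y a = y powr a"
  by (auto simp: rpow_def powr_real_of_int' elim!: Ints_cases)

lemma rpow_of_int: "rpow y (of_int n) = y powi n"
  by (simp add: rpow_def)

text \<open>The factor \<open>y\<^bsup>1-m\<^esup>\<close> of the first integral is written \<open>y \<cdot> y\<^bsup>-m\<^esup>\<close>. By the next lemma this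
  changes nothing when the powers are genuine real powers; for \<open>y < 0\<close> and non-integer \<open>m\<close> it
  selects the sign for which the phases dropped from \<open>y\<^bsup>m\<^esup>\<close>, \<open>y\<^bsup>-m\<^esup>\<close> and
  \<open>y\<^bsup>1-m\<^esup>\<close> are compatible.\<close>

lemma rpow_one_minus:
  assumes "y > 0 \<or> y \<noteq> 0 \<and> m \<in> \<int>"
  shows "y * rpow y (- m) = rpow y (1 - m)"
proof (cases "m \<in> \<int>")
  case True
  then obtain n where n: "m = of_int n" by (auto elim: Ints_cases)
  have "y \<noteq> 0" using assms by auto
  hence "y * y powi (- n) = y powi (1 - n)"
    by (simp add: power_int_diff power_int_minus field_simps)
  moreover have "- m = of_int (- n)" "1 - m = of_int (1 - n)" by (simp_all add: n)
  ultimately show ?thesis by (simp only: rpow_of_int)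
next
  case False
  with assms have "y > 0" by auto
  thus ?thesis by (simp add: rpow_pos powr_diff powr_minus field_simps)
qed

definition monomial_factor :: "real \<Rightarrow> real \<times> real \<Rightarrow> real" where
  "monomial_factor m = (\<lambda>(x, y). rpow y m)"

definition weighted_antiderivative :: "real \<Rightarrow> (real \<Rightarrow> real) \<Rightarrow> (real \<Rightarrow> real) \<Rightarrow> bool" where
  "weighted_antiderivative m \<psi> \<Psi> \<longleftrightarrow>
     (\<forall>s. s \<noteq> 0 \<longrightarrow> (\<Psi> has_real_derivative \<psi> s * rpow s (- m)) (at s))"

definition quadratic_integral :: "real \<Rightarrow> (real \<Rightarrow> real) \<Rightarrow> real \<times> real \<Rightarrow> real" where
  "quadratic_integral m \<Psi> = (\<lambda>(x, y). 1 / 2 * x\<^sup>2 * (y * rpow y (- m)) + \<Psi> y)"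

end

theory Submission
  imports Defs
begin

text \<open>
  Everything rests on the logarithmic derivative \<open>(y\<^sup>a)' = a y\<^sup>a / y\<close>, valid for \<open>y \<noteq> 0\<close> on both
  half lines and for every real \<open>a\<close>. With \<open>V = y\<^sup>m\<close> and \<open>X = (\<Phi>, -xy)\<close> it gives
  \<open>X \<cdot> \<nabla>V = -m x V\<close>, while \<open>div X = \<partial>\<^sub>x\<Phi> - x\<close>; after cancelling \<open>V \<noteq> 0\<close>, the equation
  \<open>X \<cdot> \<nabla>V = V div X\<close> says exactly \<open>\<partial>\<^sub>x\<Phi> = (1 - m) x\<close> off the axis \<open>y = 0\<close>
  (\<open>inverse_integrating_factor_monomial_iff\<close>).

  Integrating this in \<open>x\<close> along a horizontal line gives \<open>\<Phi>(x, y) = (1 - m)/2 x\<^sup>2 + \<Phi>(0, y)\<close>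
  for \<open>y \<noteq> 0\<close>. The axis itself is invisible to the inverse integrating factor, but both
  sides are continuous in \<open>y\<close>, so the formula, and with it the condition on \<open>\<partial>\<^sub>x\<Phi>\<close>,
  extends to \<open>y = 0\<close> (\<open>quadratic_off_axis_imp_quadratic\<close>). The function \<open>\<psi>\<close> is thus the
  restriction of \<open>\<Phi>\<close> to the line \<open>x = 0\<close>, and it is analytic when \<open>\<Phi>\<close> is, because setting
  \<open>h = 0\<close> in the double power series \<open>\<Sum> c\<^sub>i\<^sub>j h\<^sup>i k\<^sup>j\<close> leaves the single series
  \<open>\<Sum> c\<^sub>0\<^sub>j k\<^sup>j\<close> (\<open>real_analytic2_restrict_vertical\<close>).

  For the first integral, differentiating \<open>I\<close> gives
  \<open>\<nabla>I = y\<^bsup>-m\<^esup> (xy, \<Phi>)\<close>, so \<open>V X\<^sub>I = (\<Phi>, -xy) = X\<close>; a multiple of the Hamiltonian field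
  \<open>X\<^sub>I\<close> annihilates \<open>I\<close>, which is why \<open>X \<cdot> \<nabla>I = 0\<close> needs no further computation.
\<close>

section \<open>Signed real powers\<close>

lemma rpow_nonzero: "y \<noteq> 0 \<Longrightarrow> rpow y a \<noteq> 0"
  by (simp add: rpow_def)

lemma rpow_minus: "rpow y (- a) = inverse (rpow y a)"
proof (cases "a \<in> \<int>")
  case True
  then obtain n where n: "a = of_int n" by (auto elim: Ints_cases)
  have "rpow y (of_int (- n)) = inverse (rpow y (of_int n))"
    by (simp only: rpow_of_int power_int_minus)
  thus ?thesis by (simp add: n)
next
  case False
  thus ?thesis by (simp add: rpow_def powr_minus)
qed

text \<open>Writing the derivative as \<open>a y\<^sup>a / y\<close> rather than \<open>a y\<^bsup>a-1\<^esup>\<close> makes the rule uniform: for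
  \<open>y < 0\<close> and non-integer \<open>a\<close> the derivative of \<open>\<bar>y\<bar>\<^sup>a\<close> is \<open>a \<bar>y\<bar>\<^sup>a / y\<close>, which is
  \<open>- a \<bar>y\<bar>\<^bsup>a-1\<^esup>\<close>.\<close>

lemma rpow_has_derivative:
  assumes "y \<noteq> 0"
  shows "((\<lambda>y. rpow y a) has_real_derivative a * rpow y a / y) (at y)"
proof (cases "a \<in> \<int>")
  case True
  then obtain n where n: "a = of_int n" by (auto elim: Ints_cases)
  have "((\<lambda>y. y powi n) has_real_derivative of_int n * y powi (n - 1) * 1) (at y)"
    using assms by (intro DERIV_power_int DERIV_ident) auto
  moreover have "of_int n * y powi (n - 1) * 1 = of_int n * y powi n / y"
    using assms by (simp add: power_int_diff)
  ultimately show ?thesis by (simp add: n rpow_of_int)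
next
  case False
  \<comment> \<open>Replacing \<open>ln \<bar>y\<bar>\<close> by \<open>ln (y\<^sup>2) / 2\<close> removes the absolute value and treats both signs of
    \<open>y\<close> at once.\<close>
  have "((\<lambda>y. exp (a * (ln (y\<^sup>2) / 2))) has_real_derivative
          exp (a * (ln (y\<^sup>2) / 2)) * (a * (2 * y / y\<^sup>2 / 2))) (at y)"
    using assms by (auto intro!: derivative_eq_intros)
  moreover have eq: "exp (a * (ln (z\<^sup>2) / 2)) = rpow z a" if "z \<noteq> 0" for z
  proof -
    have "ln (z\<^sup>2) = 2 * ln \<bar>z\<bar>"
      using that ln_realpow[of "\<bar>z\<bar>" 2] by simp
    thus ?thesis using that False by (simp add: rpow_def powr_def)
  qed
  moreover have "exp (a * (ln (y\<^sup>2) / 2)) * (a * (2 * y / y\<^sup>2 / 2)) = a * rpow y a / y"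
    unfolding eq[OF assms] using assms by (simp add: power2_eq_square)
  ultimately have "((\<lambda>y. exp (a * (ln (y\<^sup>2) / 2))) has_real_derivative a * rpow y a / y) (at y)"
    by simp
  thus ?thesis
  proof (rule has_field_derivative_transform_within_open[where S = "- {0}"])
    show "exp (a * (ln (z\<^sup>2) / 2)) = rpow z a" if "z \<in> - {0}" for z
      by (rule eq) (use that in simp)
  qed (use assms in auto)
qed

section \<open>Derivatives of the vector field and of the monomial factor\<close>

lemma partial_has_derivative:
  assumes "(f has_derivative f') (at p)"
  shows "partial_x f p = f' (1, 0)" "partial_y f p = f' (0, 1)"
  using partials_of_differentiable[OF assms, THEN DERIV_imp_deriv]
  by (simp_all add: partial_x_def partial_y_def)

lemma has_derivative_snd_compose:
  assumes "(g has_real_derivative d) (at (snd p))"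
  shows "((\<lambda>q :: real \<times> real. g (snd q)) has_derivative (\<lambda>h. d * snd h)) (at p)"
  using has_derivative_compose[OF has_derivative_snd[OF has_derivative_ident]
      assms[unfolded has_field_derivative_def], of UNIV] by simp

lemma monomial_factor_has_derivative:
  assumes "snd p \<noteq> 0"
  shows "(monomial_factor m has_derivative (\<lambda>h. m * rpow (snd p) m / snd p * snd h)) (at p)"
  using has_derivative_snd_compose[OF rpow_has_derivative[OF assms]]
  by (simp add: monomial_factor_def case_prod_unfold)

lemma planar_field_has_derivative:
  assumes "(\<Phi> has_derivative \<Phi>') (at p)"
  shows "(planar_field \<Phi> has_derivative
           (\<lambda>h. (\<Phi>' h, - (fst p * snd h + fst h * snd p)))) (at p)"
proof -
  have "planar_field \<Phi> = (\<lambda>q. (\<Phi> q, - (fst q * snd q)))"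
    by (auto simp: planar_field_def)
  thus ?thesis
    using assms by (auto intro!: derivative_eq_intros)
qed

lemma quadratic_Phi_has_derivative:
  assumes "(\<psi> has_real_derivative d) (at (snd p))"
  shows "(quadratic_Phi m \<psi> has_derivative (\<lambda>h. (1 - m) * fst p * fst h + d * snd h)) (at p)"
proof -
  have "quadratic_Phi m \<psi> = (\<lambda>q. (1 - m) / 2 * (fst q)\<^sup>2 + \<psi> (snd q))"
    by (auto simp: quadratic_Phi_def)
  moreover have "((\<lambda>q. (1 - m) / 2 * (fst q)\<^sup>2 + \<psi> (snd q)) has_derivative
      (\<lambda>h. (1 - m) * fst p * fst h + d * snd h)) (at p)"
    by (rule derivative_eq_intros has_derivative_snd_compose[OF assms] refl)+ (auto simp: fun_eq_iff field_simps)
  ultimately show ?thesis by simp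
qed

lemma partial_x_quadratic_Phi: "partial_x (quadratic_Phi m \<psi>) p = (1 - m) * fst p"
proof -
  have "((\<lambda>x. (1 - m) / 2 * x\<^sup>2 + \<psi> (snd p)) has_real_derivative (1 - m) * fst p) (at (fst p))"
    by (auto intro!: derivative_eq_intros)
  thus ?thesis
    by (simp add: partial_x_def quadratic_Phi_def DERIV_imp_deriv)
qed

section \<open>The condition on the horizontal partial derivative\<close>

text \<open>Since \<open>X \<cdot> \<nabla>V = -m x V\<close> and \<open>div X = \<partial>\<^sub>x\<Phi> - x\<close>, the factor \<open>V \<noteq> 0\<close> cancels from
  \<open>X \<cdot> \<nabla>V = V div X\<close>.\<close>

lemma inverse_integrating_factor_monomial_iff:
  assumes "\<And>p. p \<in> off_axis \<Longrightarrow> \<Phi> differentiable (at p)"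
  shows "inverse_integrating_factor off_axis (planar_field \<Phi>) (monomial_factor m)
           \<longleftrightarrow> (\<forall>p\<in>off_axis. partial_x \<Phi> p = (1 - m) * fst p)"
proof -
  have "planar_field \<Phi> differentiable (at p) \<and> monomial_factor m differentiable (at p) \<and>
        monomial_factor m p \<noteq> 0 \<and>
        (directional (planar_field \<Phi>) (monomial_factor m) p
           = monomial_factor m p * divergence (planar_field \<Phi>) p
         \<longleftrightarrow> partial_x \<Phi> p = (1 - m) * fst p)" if p: "p \<in> off_axis" for p
  proof -
    have y: "snd p \<noteq> 0" using p by (simp add: off_axis_def)
    obtain \<Phi>' where \<Phi>': "(\<Phi> has_derivative \<Phi>') (at p)"
      using assms[OF p] by (auto simp: differentiable_def)
    note V' = monomial_factor_has_derivative[OF y, of m]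
    note X' = planar_field_has_derivative[OF \<Phi>']
    have V: "monomial_factor m p = rpow (snd p) m"
      by (simp add: monomial_factor_def case_prod_unfold)
    have X: "planar_field \<Phi> p = (\<Phi> p, - fst p * snd p)"
      by (simp add: planar_field_def case_prod_unfold)
    have div: "divergence (planar_field \<Phi>) p = partial_x \<Phi> p - fst p"
      using partial_has_derivative[OF has_derivative_fst[OF X']]
        partial_has_derivative[OF has_derivative_snd[OF X']] partial_has_derivative[OF \<Phi>']
      by (simp add: divergence_def)
    have dir: "directional (planar_field \<Phi>) (monomial_factor m) p = rpow (snd p) m * (- m * fst p)"
      using y by (simp add: directional_def X partial_has_derivative[OF V'])
    have "directional (planar_field \<Phi>) (monomial_factor m) p
           = monomial_factor m p * divergence (planar_field \<Phi>) p
         \<longleftrightarrow> - m * fst p = partial_x \<Phi> p - fst p"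
      unfolding dir div V using rpow_nonzero[OF y, of m] by (simp only: mult_cancel_left) simp
    also have "\<dots> \<longleftrightarrow> partial_x \<Phi> p = (1 - m) * fst p"
      by (auto simp: algebra_simps)
    finally show ?thesis
      using X' V' rpow_nonzero[OF y, of m] V by (auto simp: differentiable_def)
  qed
  thus ?thesis
    by (auto simp: inverse_integrating_factor_alt)
qed

text \<open>The difference of \<open>\<Phi>(x, y)\<close> and \<open>(1 - m)/2 x\<^sup>2\<close> has zero derivative in \<open>x\<close>, so it keeps
  its value at \<open>x = 0\<close>. Only one horizontal line enters, so the lemma applies off the axis as
  well as on the whole plane.\<close>

lemma horizontal_partial_determines:
  assumes diff: "\<And>x. \<Phi> differentiable (at (x, y))"
    and px: "\<And>x. partial_x \<Phi> (x, y) = (1 - m) * x"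
  shows "\<Phi> (x, y) = (1 - m) / 2 * x\<^sup>2 + \<Phi> (0, y)"
proof -
  have "((\<lambda>x. \<Phi> (x, y) - (1 - m) / 2 * x\<^sup>2) has_real_derivative 0) (at x)" for x
  proof -
    obtain \<Phi>' where \<Phi>': "(\<Phi> has_derivative \<Phi>') (at (x, y))"
      using diff by (auto simp: differentiable_def)
    have "((\<lambda>x. \<Phi> (x, y)) has_real_derivative (1 - m) * x) (at x)"
      using partials_of_differentiable(1)[OF \<Phi>'] partial_has_derivative(1)[OF \<Phi>'] px by simp
    thus ?thesis by (auto intro!: derivative_eq_intros)
  qed
  hence "\<Phi> (x, y) - (1 - m) / 2 * x\<^sup>2 = \<Phi> (0, y) - (1 - m) / 2 * 0\<^sup>2"
    by (intro DERIV_isconst_all[where x = x and y = 0 and f = "\<lambda>x. \<Phi> (x, y) - (1 - m) / 2 * x\<^sup>2"]) blast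
  thus ?thesis by simp
qed

lemma quadratic_Phi_iff:
  assumes "\<And>p. \<Phi> differentiable (at p)"
  shows "(\<forall>p. partial_x \<Phi> p = (1 - m) * fst p) \<longleftrightarrow> \<Phi> = quadratic_Phi m (\<lambda>y. \<Phi> (0, y))"
proof
  assume px: "\<forall>p. partial_x \<Phi> p = (1 - m) * fst p"
  have "\<Phi> (x, y) = quadratic_Phi m (\<lambda>y. \<Phi> (0, y)) (x, y)" for x y
    using horizontal_partial_determines[of \<Phi> y m x] assms px by (simp add: quadratic_Phi_def)
  thus "\<Phi> = quadratic_Phi m (\<lambda>y. \<Phi> (0, y))"
    by (intro ext) (metis surj_pair)
next
  assume "\<Phi> = quadratic_Phi m (\<lambda>y. \<Phi> (0, y))"
  thus "\<forall>p. partial_x \<Phi> p = (1 - m) * fst p"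
    by (metis partial_x_quadratic_Phi)
qed

text \<open>The axis \<open>y = 0\<close> has empty interior, so continuity of \<open>\<Phi>\<close> carries the quadratic formula
  across it. This is what upgrades the condition on \<open>\<partial>\<^sub>x\<Phi>\<close> from \<open>y \<noteq> 0\<close> to all points.\<close>

lemma quadratic_off_axis_imp_quadratic:
  assumes diff: "\<And>p. \<Phi> differentiable (at p)"
    and px: "\<And>p. p \<in> off_axis \<Longrightarrow> partial_x \<Phi> p = (1 - m) * fst p"
  shows "\<Phi> = quadratic_Phi m (\<lambda>y. \<Phi> (0, y))"
proof -
  have off: "\<Phi> (x, y) = (1 - m) / 2 * x\<^sup>2 + \<Phi> (0, y)" if "y \<noteq> 0" for x y
    using that by (intro horizontal_partial_determines diff px[of "(_, y)", simplified])
      (simp add: off_axis_def)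
  have lim: "((\<lambda>y. \<Phi> (x, y)) \<longlongrightarrow> \<Phi> (x, 0)) (at 0)" for x
  proof -
    have "isCont \<Phi> (x, 0)"
      using diff by (rule differentiable_imp_continuous_within)
    moreover have "((\<lambda>y. (x, y)) \<longlongrightarrow> (x, 0)) (at 0)"
      by (intro tendsto_intros)
    ultimately show ?thesis by (rule isCont_tendsto_compose)
  qed
  have "\<Phi> (x, 0) = (1 - m) / 2 * x\<^sup>2 + \<Phi> (0, 0)" for x
  proof (rule tendsto_unique[OF _ lim])
    have "((\<lambda>y. (1 - m) / 2 * x\<^sup>2 + \<Phi> (0, y)) \<longlongrightarrow> (1 - m) / 2 * x\<^sup>2 + \<Phi> (0, 0)) (at 0)"
      by (intro tendsto_intros lim)
    thus "((\<lambda>y. \<Phi> (x, y)) \<longlongrightarrow> (1 - m) / 2 * x\<^sup>2 + \<Phi> (0, 0)) (at 0)"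
      by (rule Lim_transform_eventually) (simp add: eventually_at_filter off[where x = x])
  qed simp
  with off show ?thesis
    by (auto simp: quadratic_Phi_def fun_eq_iff) metis
qed

section \<open>Analyticity\<close>

lemma real_analytic_differentiable:
  assumes "real_analytic f"
  obtains d where "(f has_real_derivative d) (at a)"
proof -
  obtain F where F: "(\<lambda>h. f (a + h)) has_fps_expansion F"
    using assms by (auto simp: real_analytic_def)
  define d where "d = eval_fps (fps_deriv F) 0"
  have "(eval_fps F has_real_derivative d) (at 0)"
    unfolding d_def using F
    by (intro has_field_derivative_eval_fps) (simp add: has_fps_expansion_def zero_ereal_def)
  moreover have "eventually (\<lambda>h. eval_fps F h = f (a + h)) (nhds 0)"
    using F by (simp add: has_fps_expansion_def)
  from DERIV_cong_ev[OF refl this refl]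
  have "(eval_fps F has_real_derivative d) (at 0) \<longleftrightarrow>
          ((\<lambda>h. f (a + h)) has_real_derivative d) (at 0)" .
  ultimately have "((\<lambda>h. f (a + h)) has_real_derivative d) (at 0)"
    by simp
  hence "(f has_real_derivative d) (at a)"
    using DERIV_shift[of f d 0 a] by (simp add: add.commute)
  thus thesis by (rule that)
qed

text \<open>With the horizontal increment \<open>h = 0\<close> only the terms \<open>i = 0\<close> of the double series survive
  (\<open>0\<^sup>0 = 1\<close>), leaving a power series in the vertical increment.\<close>

lemma real_analytic2_restrict_vertical:
  assumes "real_analytic2 \<Phi>"
  shows "real_analytic (\<lambda>y. \<Phi> (a, y))"
  unfolding real_analytic_def
proof
  fix b
  obtain c :: "nat \<Rightarrow> nat \<Rightarrow> real" and r where r: "r > 0"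
    and c: "\<And>h k. \<bar>h\<bar> < r \<Longrightarrow> \<bar>k\<bar> < r \<Longrightarrow>
              ((\<lambda>(i, j). c i j * h ^ i * k ^ j) has_sum \<Phi> (a + h, b + k)) UNIV"
    using assms[unfolded real_analytic2_def, rule_format, of a b] by blast
  have sums: "(\<lambda>j. c 0 j * k ^ j) sums \<Phi> (a, b + k)" if k: "\<bar>k\<bar> < r" for k
  proof -
    have "((\<lambda>(i, j). c i j * 0 ^ i * k ^ j) has_sum \<Phi> (a, b + k)) UNIV"
      using c[of 0 k] r k by simp
    also have "?this \<longleftrightarrow> ((\<lambda>(i, j). c i j * 0 ^ i * k ^ j) has_sum \<Phi> (a, b + k)) (range (Pair 0))"
      by (rule has_sum_cong_neutral) (auto simp: image_iff)
    also have "\<dots> \<longleftrightarrow> ((\<lambda>j. c 0 j * k ^ j) has_sum \<Phi> (a, b + k)) UNIV"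
      by (subst has_sum_reindex) (auto simp: inj_on_def o_def)
    finally show ?thesis by (rule has_sum_imp_sums)
  qed
  have "fps_conv_radius (Abs_fps (c 0)) \<ge> ereal r"
    unfolding fps_conv_radius_def
  proof (rule conv_radius_geI_ex)
    fix s assume "0 < s" "ereal s < ereal r"
    thus "\<exists>z. norm z = s \<and> summable (\<lambda>n. fps_nth (Abs_fps (c 0)) n * z ^ n)"
      using sums[of s] by (intro exI[of _ s]) (auto dest: sums_summable)
  qed
  moreover have "eventually (\<lambda>k. eval_fps (Abs_fps (c 0)) k = \<Phi> (a, b + k)) (nhds 0)"
  proof -
    have "eventually (\<lambda>k. k \<in> {-r<..<r}) (nhds (0::real))"
      using r by (intro eventually_nhds_in_open) auto
    thus ?thesis
      by eventually_elim (auto simp: eval_fps_def intro!: sums_unique[symmetric] sums)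
  qed
  ultimately have "(\<lambda>k. \<Phi> (a, b + k)) has_fps_expansion Abs_fps (c 0)"
    using r by (auto simp: has_fps_expansion_def intro: less_le_trans[of 0 "ereal r"])
  thus "\<exists>F. (\<lambda>k. \<Phi> (a, b + k)) has_fps_expansion F" ..
qed

section \<open>The first integral\<close>

text \<open>The integrand may be singular at \<open>0\<close>, so an antiderivative is taken on each half line;
  the derivative is a local notion, so the two join to one function on \<open>s \<noteq> 0\<close>.\<close>

lemma weighted_antiderivative_exists:
  assumes "\<And>y. isCont \<psi> y"
  shows "\<exists>\<Psi>. weighted_antiderivative m \<psi> \<Psi>"
proof -
  define g where "g s = \<psi> s * rpow s (- m)" for s
  have cont: "isCont g s" if "s \<noteq> 0" for s
    unfolding g_def
    by (intro continuous_mult assms DERIV_isCont[OF rpow_has_derivative[OF that]])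
  have "\<exists>F. \<forall>s. 0 < ereal s \<longrightarrow> ereal s < \<infinity> \<longrightarrow> (F has_vector_derivative g s) (at s)"
    by (rule einterval_antiderivative) (auto simp: zero_ereal_def intro!: cont)
  then obtain F where F: "\<And>s. s > 0 \<Longrightarrow> (F has_vector_derivative g s) (at s)"
    by auto
  have "\<exists>G. \<forall>s. -\<infinity> < ereal s \<longrightarrow> ereal s < 0 \<longrightarrow> (G has_vector_derivative g s) (at s)"
    by (rule einterval_antiderivative) (auto simp: zero_ereal_def intro!: cont)
  then obtain G where G: "\<And>s. s < 0 \<Longrightarrow> (G has_vector_derivative g s) (at s)"
    by auto
  have "((\<lambda>s. if s > 0 then F s else G s) has_real_derivative g s) (at s)" if "s \<noteq> 0" for s
  proof (cases "s > 0")
    case True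
    show ?thesis
      by (rule has_field_derivative_transform_within_open[of F _ _ "{0<..}"])
        (use True F in \<open>auto simp: has_real_derivative_iff_has_vector_derivative\<close>)
  next
    case False
    show ?thesis
      by (rule has_field_derivative_transform_within_open[of G _ _ "{..<0}"])
        (use False that G in \<open>auto simp: has_real_derivative_iff_has_vector_derivative\<close>)
  qed
  thus ?thesis
    by (auto simp: weighted_antiderivative_def g_def)
qed

text \<open>In the \<open>y\<close>-derivative, \<open>1/2 x\<^sup>2 (y y\<^bsup>-m\<^esup>)' = (1 - m)/2 x\<^sup>2 y\<^bsup>-m\<^esup>\<close> combines with
  \<open>\<psi> y\<^bsup>-m\<^esup>\<close> to \<open>y\<^bsup>-m\<^esup> \<Phi>\<close>.\<close>

lemma quadratic_integral_has_derivative: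
  assumes "weighted_antiderivative m \<psi> \<Psi>" "snd p \<noteq> 0"
  shows "(quadratic_integral m \<Psi> has_derivative
           (\<lambda>h. rpow (snd p) (- m) * (fst p * snd p * fst h + quadratic_Phi m \<psi> p * snd h))) (at p)"
proof -
  have eq: "quadratic_integral m \<Psi> =
      (\<lambda>q. 1 / 2 * (fst q)\<^sup>2 * (snd q * rpow (snd q) (- m)) + \<Psi> (snd q))"
    by (auto simp: quadratic_integral_def)
  have \<Psi>: "(\<Psi> has_real_derivative \<psi> (snd p) * rpow (snd p) (- m)) (at (snd p))"
    using assms by (simp add: weighted_antiderivative_def)
  show ?thesis
    unfolding eq
    by (rule derivative_eq_intros has_derivative_snd_compose[OF \<Psi>]
        has_derivative_snd_compose[OF rpow_has_derivative[OF assms(2)]] refl)+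
      (use assms(2) in \<open>auto simp: fun_eq_iff quadratic_Phi_def case_prod_unfold field_simps power2_eq_square\<close>)
qed

lemma planar_field_eq_hamiltonian:
  assumes "weighted_antiderivative m \<psi> \<Psi>" "p \<in> off_axis"
  shows "planar_field (quadratic_Phi m \<psi>) p =
           monomial_factor m p *\<^sub>R hamiltonian_field (quadratic_integral m \<Psi>) p"
proof -
  have y: "snd p \<noteq> 0" using assms by (simp add: off_axis_def)
  show ?thesis
    using rpow_nonzero[OF y, of m]
      partial_has_derivative[OF quadratic_integral_has_derivative[OF assms(1) y]]
    by (simp add: planar_field_def hamiltonian_field_def monomial_factor_def
        case_prod_unfold rpow_minus)
qed

lemma directional_scaled_hamiltonian:
  assumes "X p = c *\<^sub>R hamiltonian_field f p"
  shows "directional X f p = 0"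
  by (simp add: assms directional_def hamiltonian_field_def)

lemma quadratic_integral_first_integral:
  assumes "weighted_antiderivative m \<psi> \<Psi>"
  shows "first_integral off_axis (planar_field (quadratic_Phi m \<psi>)) (quadratic_integral m \<Psi>)"
  unfolding first_integral_def
proof (intro ballI conjI)
  fix p assume p: "p \<in> off_axis"
  show "quadratic_integral m \<Psi> differentiable at p"
    using quadratic_integral_has_derivative[OF assms, of p] p
    by (auto simp: differentiable_def off_axis_def)
  show "directional (planar_field (quadratic_Phi m \<psi>)) (quadratic_integral m \<Psi>) p = 0"
    by (rule directional_scaled_hamiltonian, rule planar_field_eq_hamiltonian[OF assms p])
qed

section \<open>The characterisation\<close>

theorem proposition3p1:
  fixes m :: real
  shows "(\<forall>\<psi>. real_analytic \<psi> \<longrightarrow>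
            inverse_integrating_factor off_axis (planar_field (quadratic_Phi m \<psi>)) (monomial_factor m) \<and>
            (\<exists>\<Psi>. weighted_antiderivative m \<psi> \<Psi>) \<and>
            (\<forall>\<Psi>. weighted_antiderivative m \<psi> \<Psi> \<longrightarrow>
               first_integral off_axis (planar_field (quadratic_Phi m \<psi>)) (quadratic_integral m \<Psi>) \<and>
               (\<forall>p\<in>off_axis. planar_field (quadratic_Phi m \<psi>) p =
                  monomial_factor m p *\<^sub>R hamiltonian_field (quadratic_integral m \<Psi>) p)))
       \<and> (\<forall>\<Phi> :: real \<times> real \<Rightarrow> real. (\<forall>p. \<Phi> differentiable (at p)) \<longrightarrow>
            (inverse_integrating_factor off_axis (planar_field \<Phi>) (monomial_factor m)
               \<longleftrightarrow> (\<forall>p. partial_x \<Phi> p = (1 - m) * fst p)) \<and>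
            ((\<forall>p. partial_x \<Phi> p = (1 - m) * fst p)
               \<longleftrightarrow> (\<exists>\<psi>. \<Phi> = quadratic_Phi m \<psi>)) \<and>
            (real_analytic2 \<Phi> \<longrightarrow>
               ((\<forall>p. partial_x \<Phi> p = (1 - m) * fst p)
                  \<longleftrightarrow> (\<exists>\<psi>. real_analytic \<psi> \<and> \<Phi> = quadratic_Phi m \<psi>))))"
proof (intro conjI allI impI)
  fix \<psi> assume \<psi>: "real_analytic \<psi>"
  have "quadratic_Phi m \<psi> differentiable (at p)" for p
    using real_analytic_differentiable[OF \<psi>, of "snd p"] quadratic_Phi_has_derivative
    by (metis differentiable_def)
  thus "inverse_integrating_factor off_axis (planar_field (quadratic_Phi m \<psi>)) (monomial_factor m)"
    by (simp add: inverse_integrating_factor_monomial_iff partial_x_quadratic_Phi)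
  show "\<exists>\<Psi>. weighted_antiderivative m \<psi> \<Psi>"
    by (rule weighted_antiderivative_exists) (metis real_analytic_differentiable[OF \<psi>] DERIV_isCont)
next
  fix \<psi> \<Psi> assume "weighted_antiderivative m \<psi> \<Psi>"
  thus "first_integral off_axis (planar_field (quadratic_Phi m \<psi>)) (quadratic_integral m \<Psi>)"
    and "\<forall>p\<in>off_axis. planar_field (quadratic_Phi m \<psi>) p =
           monomial_factor m p *\<^sub>R hamiltonian_field (quadratic_integral m \<Psi>) p"
    by (simp_all add: quadratic_integral_first_integral planar_field_eq_hamiltonian)
next
  fix \<Phi> :: "real \<times> real \<Rightarrow> real"
  assume diff: "\<forall>p. \<Phi> differentiable (at p)"
  show "inverse_integrating_factor off_axis (planar_field \<Phi>) (monomial_factor m)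
          \<longleftrightarrow> (\<forall>p. partial_x \<Phi> p = (1 - m) * fst p)"
    using diff inverse_integrating_factor_monomial_iff[of \<Phi> m]
      quadratic_off_axis_imp_quadratic[of \<Phi> m] quadratic_Phi_iff[of \<Phi> m] by metis
  show "(\<forall>p. partial_x \<Phi> p = (1 - m) * fst p) \<longleftrightarrow> (\<exists>\<psi>. \<Phi> = quadratic_Phi m \<psi>)"
    using diff quadratic_Phi_iff[of \<Phi> m] partial_x_quadratic_Phi by metis
  show "(\<forall>p. partial_x \<Phi> p = (1 - m) * fst p)
          \<longleftrightarrow> (\<exists>\<psi>. real_analytic \<psi> \<and> \<Phi> = quadratic_Phi m \<psi>)" if "real_analytic2 \<Phi>"
    using diff quadratic_Phi_iff[of \<Phi> m] partial_x_quadratic_Phi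
      real_analytic2_restrict_vertical[OF that, of 0] by metis
qed

end
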